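(* Let $\delta\ge0$. No nontrivial element of $\mathrm{Aut}(\mathbb{H}_\delta)=\mathrm{Isom}(\mathbb{H}_\delta)$ has bounded displacement; i.e. if $g$ is an isometry of $\mathbb{H}_\delta$ with $\sup_{x\in\mathbb{H}_\delta}d(x,g(x))<\infty$, then $g=\mathrm{id}$.
   Context: A metric space $(X,d)$ is $\delta$-hyperbolic if for all $x_1,\dots,x_4\in X$ one has $d(x_1,x_4)+d(x_2,x_3)\le\max\{d(x_1,x_2)+d(x_3,x_4),\,d(x_1,x_3)+d(x_2,x_4)\}+2\delta$. A subset $A$ of a metric space $X$ is gated in $X$ if for every $b\in X\setminus A$ there is a (necessarily unique) gate $g_A(b)\in A$ such that $d(b,a)=d(b,g_A(b))+d(g_A(b),a)$ for all $a\in A$. A nonempty $A\subseteq X$ is $\delta$-closed in $X$ if $A$ is gated in $X$ and for all $b,b'\in X\setminus A$ with $d(g_A(b),g_A(b'))>\delta$ we have $d(b,b')=d(b,g_A(b))+d(g_A(b),g_A(b'))+d(g_A(b'),b')$. $\mathbb{H}_\delta$ denotes the countable $\delta$-hyperbolic metric space with rational distances, unique up to isometry, such that: it is the union of a countable chain of finite $\delta$-closed subsets; every finite $\delta$-hyperbolic metric space with rational distances is isometric to a $\delta$-closed subset of $\mathbb{H}_\delta$; and every isometry between finite $\delta$-closed subsets of $\mathbb{H}_\delta$ extends to an isometry of $\mathbb{H}_\delta$ onto itself. *)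

theory Defs
  imports "HOL-Analysis.Abstract_Metric_Spaces"
begin

definition hyperbolic :: "real \<Rightarrow> 'a set \<Rightarrow> ('a \<Rightarrow> 'a \<Rightarrow> real) \<Rightarrow> bool" where
  "hyperbolic \<delta> X d \<longleftrightarrow>
     Metric_space X d \<and>
     (\<forall>x1\<in>X. \<forall>x2\<in>X. \<forall>x3\<in>X. \<forall>x4\<in>X.
        d x1 x4 + d x2 x3 \<le> max (d x1 x2 + d x3 x4) (d x1 x3 + d x2 x4) + 2 * \<delta>)"

definition rational_distances :: "'a set \<Rightarrow> ('a \<Rightarrow> 'a \<Rightarrow> real) \<Rightarrow> bool" where
  "rational_distances X d \<longleftrightarrow> (\<forall>x\<in>X. \<forall>y\<in>X. d x y \<in> \<rat>)"

definition isometry_between ::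
  "'a set \<Rightarrow> ('a \<Rightarrow> 'a \<Rightarrow> real) \<Rightarrow> 'b set \<Rightarrow> ('b \<Rightarrow> 'b \<Rightarrow> real) \<Rightarrow> ('a \<Rightarrow> 'b) \<Rightarrow> bool" where
  "isometry_between X d Y e f \<longleftrightarrow>
     bij_betw f X Y \<and> (\<forall>x\<in>X. \<forall>y\<in>X. e (f x) (f y) = d x y)"

definition is_gate :: "('a \<Rightarrow> 'a \<Rightarrow> real) \<Rightarrow> 'a set \<Rightarrow> 'a \<Rightarrow> 'a \<Rightarrow> bool" where
  "is_gate d A b g \<longleftrightarrow> g \<in> A \<and> (\<forall>a\<in>A. d b a = d b g + d g a)"

definition gated :: "'a set \<Rightarrow> ('a \<Rightarrow> 'a \<Rightarrow> real) \<Rightarrow> 'a set \<Rightarrow> bool" where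
  "gated X d A \<longleftrightarrow> A \<subseteq> X \<and> (\<forall>b\<in>X - A. \<exists>g. is_gate d A b g)"

definition gate :: "('a \<Rightarrow> 'a \<Rightarrow> real) \<Rightarrow> 'a set \<Rightarrow> 'a \<Rightarrow> 'a" where
  "gate d A b = (THE g. is_gate d A b g)"

lemma is_gate_unique:
  assumes "Metric_space X d" "A \<subseteq> X" "is_gate d A b g" "is_gate d A b h"
  shows "g = h"
proof -
  interpret Metric_space X d by (fact assms(1))
  have gh: "g \<in> A" "h \<in> A"
    and "\<forall>a\<in>A. d b a = d b g + d g a" "\<forall>a\<in>A. d b a = d b h + d h a"
    using assms(3,4) unfolding is_gate_def by blast+
  then have "d b h = d b g + d g h" "d b g = d b h + d h g"
    by blast+
  then have "d g h = 0"
    using commute[of g h] by linarith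
  then show ?thesis using gh assms(2) by (simp add: subset_iff)
qed

lemma is_gate_gate:
  assumes "Metric_space X d" "gated X d A" "b \<in> X - A"
  shows "is_gate d A b (gate d A b)"
proof -
  obtain g where g: "is_gate d A b g" and A: "A \<subseteq> X"
    using assms(2,3) unfolding gated_def by blast
  show ?thesis
    unfolding gate_def
  proof (rule theI)
    show "is_gate d A b g" by (fact g)
    show "h = g" if "is_gate d A b h" for h
      by (rule is_gate_unique[OF assms(1) A that g])
  qed
qed

definition delta_closed :: "real \<Rightarrow> 'a set \<Rightarrow> ('a \<Rightarrow> 'a \<Rightarrow> real) \<Rightarrow> 'a set \<Rightarrow> bool" where
  "delta_closed \<delta> X d A \<longleftrightarrow>
     A \<noteq> {} \<and> gated X d A \<and>
     (\<forall>b\<in>X - A. \<forall>b'\<in>X - A.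
        d (gate d A b) (gate d A b') > \<delta> \<longrightarrow>
        d b b' = d b (gate d A b) + d (gate d A b) (gate d A b') + d (gate d A b') b')"

text \<open>
  The space \<open>H\<^sub>\<delta>\<close> is unique only up to isometry, so it is specified by a predicate on
  metric spaces. In the embedding property the finite spaces are taken with carriers in
  \<^typ>\<open>nat\<close>, which covers every finite metric space up to isometry; they are nonempty because
  \<open>\<delta>\<close>-closed subsets are. A countable chain of finite sets is given as an increasing sequence,
  which may be eventually constant.
\<close>

definition is_H_delta :: "real \<Rightarrow> 'a set \<Rightarrow> ('a \<Rightarrow> 'a \<Rightarrow> real) \<Rightarrow> bool" where
  "is_H_delta \<delta> H d \<longleftrightarrow>
     countable H \<and> hyperbolic \<delta> H d \<and> rational_distances H d \<and>
     (\<exists>C :: nat \<Rightarrow> 'a set. incseq C \<and>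
        (\<forall>n. finite (C n) \<and> delta_closed \<delta> H d (C n)) \<and> (\<Union>n. C n) = H) \<and>
     (\<forall>(F :: nat set) e. finite F \<and> F \<noteq> {} \<and> hyperbolic \<delta> F e \<and> rational_distances F e \<longrightarrow>
        (\<exists>A f. delta_closed \<delta> H d A \<and> isometry_between F e A d f)) \<and>
     (\<forall>A B f. finite A \<and> finite B \<and> delta_closed \<delta> H d A \<and> delta_closed \<delta> H d B \<and>
        isometry_between A d B d f \<longrightarrow>
        (\<exists>h. isometry_between H d H d h \<and> (\<forall>x\<in>A. h x = f x)))"

definition bounded_displacement :: "'a set \<Rightarrow> ('a \<Rightarrow> 'a \<Rightarrow> real) \<Rightarrow> ('a \<Rightarrow> 'a) \<Rightarrow> bool" where
  "bounded_displacement X d g \<longleftrightarrow> bdd_above ((\<lambda>x. d x (g x)) ` X)"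

end

theory Submission
  imports Defs
begin

text \<open>
  Suppose \<open>g x \<noteq> x\<close> and choose a finite \<open>\<delta>\<close>-closed set \<open>C\<close> containing \<open>x\<close> and \<open>g x\<close>. Hang a new
  point at \<open>x\<close> by an edge whose length \<open>N\<close> exceeds the displacement of \<open>g\<close>. By universality and
  homogeneity the resulting space is realised over \<open>C\<close>: there is \<open>q\<close> in \<open>H\<close> with gate \<open>x\<close> in \<open>C\<close>,
  \<open>d q x = N\<close>, and \<open>insert q C\<close> is \<open>\<delta>\<close>-closed. The gate of \<open>g q\<close> in \<open>insert q C\<close> cannot lie in \<open>C\<close>,
  since then \<open>d (g q) q \<ge> N\<close>; but if it is \<open>q\<close>, then
  \<open>N = d (g q) (g x) = d (g q) q + d q (g x) \<ge> N + d x (g x) > N\<close>.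
\<close>

section \<open>Gates and closed sets\<close>

lemma is_gateI: "g \<in> A \<Longrightarrow> (\<And>a. a \<in> A \<Longrightarrow> d b a = d b g + d g a) \<Longrightarrow> is_gate d A b g"
  unfolding is_gate_def by blast

lemma is_gate_mem: "is_gate d A b g \<Longrightarrow> g \<in> A"
  unfolding is_gate_def by blast

lemma is_gate_dist: "is_gate d A b g \<Longrightarrow> a \<in> A \<Longrightarrow> d b a = d b g + d g a"
  unfolding is_gate_def by blast

lemma is_gate_self:
  assumes "Metric_space X d" "A \<subseteq> X" "a \<in> A"
  shows "is_gate d A a a"
  using assms Metric_space.zero[OF assms(1), of a a] by (auto intro!: is_gateI)

text \<open>
  If points of \<open>A\<close> count as their own gates, the clauses of \<^const>\<open>delta_closed\<close> hold for all points
  of \<open>X\<close>, which removes the case distinctions from the transitivity proof.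
\<close>

lemma delta_closed_iff:
  assumes M: "Metric_space X d"
  shows "delta_closed \<delta> X d A \<longleftrightarrow>
    A \<noteq> {} \<and> A \<subseteq> X \<and> (\<forall>b\<in>X. \<exists>g. is_gate d A b g) \<and>
    (\<forall>b\<in>X. \<forall>b'\<in>X. \<forall>g g'. is_gate d A b g \<and> is_gate d A b' g' \<and> d g g' > \<delta> \<longrightarrow>
       d b b' = d b g + d g g' + d g' b')"
    (is "?L \<longleftrightarrow> ?R")
proof
  interpret Metric_space X d by (fact M)
  assume L: ?L
  then have sub: "A \<subseteq> X" and gd: "gated X d A" and ne: "A \<noteq> {}"
    unfolding delta_closed_def gated_def by auto
  have "\<exists>g. is_gate d A b g" if "b \<in> X" for b
    using gd that is_gate_self[OF M sub] unfolding gated_def by (cases "b \<in> A") auto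
  moreover have "d b b' = d b g + d g g' + d g' b'"
    if b: "b \<in> X" "b' \<in> X" and g: "is_gate d A b g" "is_gate d A b' g'" and gt: "d g g' > \<delta>"
    for b b' g g'
  proof -
    have gA: "g \<in> A" "g' \<in> A" using g by (auto dest: is_gate_mem)
    \<comment> \<open>A point of \<open>A\<close> is its own gate, so in the first two cases one
      summand vanishes and the formula is the gate equation of the other point.\<close>
    consider "b \<in> A" | "b' \<in> A" | "b \<notin> A" "b' \<notin> A" by blast
    then show ?thesis
    proof cases
      case 1
      then have "g = b" using is_gate_unique[OF M sub g(1)] is_gate_self[OF M sub] by blast
      moreover have "d b' b = d b' g' + d g' b" using g(2) 1 by (rule is_gate_dist)
      ultimately show ?thesis
        using commute[of b b'] commute[of g' b'] commute[of b g'] b by simp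
    next
      case 2
      then have "g' = b'" using is_gate_unique[OF M sub g(2)] is_gate_self[OF M sub] by blast
      moreover have "d b b' = d b g + d g b'" using g(1) 2 by (rule is_gate_dist)
      ultimately show ?thesis using b by simp
    next
      case 3
      then have "gate d A b = g" "gate d A b' = g'"
        using is_gate_gate[OF M gd] is_gate_unique[OF M sub] g b by blast+
      then show ?thesis using L gt b 3 unfolding delta_closed_def by auto
    qed
  qed
  ultimately show ?R using sub ne by blast
next
  assume R: ?R
  then have gd: "gated X d A" unfolding gated_def by blast
  then show ?L
    using R is_gate_gate[OF M gd] unfolding delta_closed_def by blast
qed

lemma delta_closed_subset: "delta_closed \<delta> X d A \<Longrightarrow> A \<subseteq> X"
  unfolding delta_closed_def gated_def by blast

lemma delta_closed_nonempty: "delta_closed \<delta> X d A \<Longrightarrow> A \<noteq> {}"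
  unfolding delta_closed_def by blast

lemma delta_closed_gate_exists:
  assumes "Metric_space X d" "delta_closed \<delta> X d A" "b \<in> X"
  obtains g where "is_gate d A b g"
  using assms(2,3) unfolding delta_closed_iff[OF assms(1)] by blast

lemma delta_closed_dist:
  assumes "Metric_space X d" "delta_closed \<delta> X d A" "b \<in> X" "b' \<in> X"
    "is_gate d A b g" "is_gate d A b' g'" "d g g' > \<delta>"
  shows "d b b' = d b g + d g g' + d g' b'"
  using assms(2-) unfolding delta_closed_iff[OF assms(1)] by metis

section \<open>Transitivity of closedness\<close>

lemma is_gate_trans:
  assumes "B \<subseteq> A" "is_gate d A b a" "is_gate d B a g"
  shows "is_gate d B b g"
proof (rule is_gateI)
  show g: "g \<in> B" using assms(3) by (rule is_gate_mem)
  fix c assume "c \<in> B"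
  \<comment> \<open>Both \<open>c\<close> and \<open>g\<close> lie in \<open>A\<close>, so
    \<open>d b c\<close> and \<open>d b g\<close> split at \<open>a\<close>; the gate equation of
    \<open>a\<close> compares the remainders.\<close>
  then have "c \<in> A" "g \<in> A" using g assms(1) by auto
  then show "d b c = d b g + d g c"
    using is_gate_dist[OF assms(2)] is_gate_dist[OF assms(3) \<open>c \<in> B\<close>] by simp
qed

text \<open>Gates compose. If the gates \<open>g\<close>, \<open>g'\<close> in \<open>B\<close> are
  more than \<delta> apart, additivity inside \<open>A\<close> makes the gates \<open>a\<close>,
  \<open>a'\<close> in \<open>A\<close> at least as far apart, so additivity over \<open>A\<close>
  applies as well and the two formulas concatenate.\<close>

lemma delta_closed_trans:
  assumes M: "Metric_space X d" and A: "delta_closed \<delta> X d A" and B: "delta_closed \<delta> A d B"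
  shows "delta_closed \<delta> X d B"
proof -
  interpret Metric_space X d by (fact M)
  have AX: "A \<subseteq> X" and BA: "B \<subseteq> A" and "B \<noteq> {}"
    using delta_closed_subset[OF A] delta_closed_subset[OF B] delta_closed_nonempty[OF B] by auto
  have BX: "B \<subseteq> X" using AX BA by simp
  have MA: "Metric_space A d" using AX by (rule subspace)
  have gate: "\<exists>a g. a \<in> A \<and> is_gate d A b a \<and> is_gate d B a g \<and> is_gate d B b g"
    if b: "b \<in> X" for b
  proof -
    obtain a where a: "is_gate d A b a" by (rule delta_closed_gate_exists[OF M A b])
    then have "a \<in> A" by (rule is_gate_mem)
    then obtain g where "is_gate d B a g" by (rule delta_closed_gate_exists[OF MA B])
    then show ?thesis using a \<open>a \<in> A\<close> is_gate_trans[OF BA] by fast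
  qed
  \<comment> \<open>By uniqueness, every gate in \<open>B\<close> arises by passing through the gate
    in \<open>A\<close>.\<close>
  have gate': "\<exists>a. a \<in> A \<and> is_gate d A b a \<and> is_gate d B a g"
    if "b \<in> X" "is_gate d B b g" for b g
    using gate[OF that(1)] is_gate_unique[OF M BX that(2)] by fast
  have "d b b' = d b g + d g g' + d g' b'"
    if b: "b \<in> X" "b' \<in> X" and g: "is_gate d B b g" "is_gate d B b' g'" and gt: "d g g' > \<delta>"
    for b b' g g'
  proof -
    obtain a where a: "a \<in> A" "is_gate d A b a" "is_gate d B a g"
      using gate'[OF b(1) g(1)] by auto
    obtain a' where a': "a' \<in> A" "is_gate d A b' a'" "is_gate d B a' g'"
      using gate'[OF b(2) g(2)] by auto
    have gA: "g \<in> A" "g' \<in> A" using g BA is_gate_mem by fast+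
    have 1: "d a a' = d a g + d g g' + d g' a'"
      by (rule delta_closed_dist[OF MA B a(1) a'(1) a(3) a'(3) gt])
    then have "d a a' > \<delta>" using gt nonneg[of a g] nonneg[of g' a'] by linarith
    then have 2: "d b b' = d b a + d a a' + d a' b'"
      by (rule delta_closed_dist[OF M A b a(2) a'(2)])
    have "d b g = d b a + d a g" "d b' g' = d b' a' + d a' g'"
      using is_gate_dist[OF a(2) gA(1)] is_gate_dist[OF a'(2) gA(2)] by auto
    then show ?thesis
      using 1 2 commute[of b' g'] commute[of b' a'] commute[of a' g'] by linarith
  qed
  moreover have "\<forall>b\<in>X. \<exists>g. is_gate d B b g" using gate by fast
  ultimately show ?thesis
    unfolding delta_closed_iff[OF M] using \<open>B \<noteq> {}\<close> BX by simp
qed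

section \<open>Transport along isometries\<close>

text \<open>\<open>Metric_space\<close> demands nonnegativity and symmetry on the whole type,
  whereas an isometry controls \<open>e\<close> on \<open>Y\<close> alone; hence the two extra
  assumptions.\<close>

lemma isometry_between_metric_space:
  assumes M: "Metric_space X d" and f: "isometry_between X d Y e f"
    and "\<And>x y. 0 \<le> e x y" "\<And>x y. e x y = e y x"
  shows "Metric_space Y e"
proof -
  interpret Metric_space X d by (fact M)
  have Y: "Y = f ` X" and e: "\<And>x y. x \<in> X \<Longrightarrow> y \<in> X \<Longrightarrow> e (f x) (f y) = d x y"
    and inj: "inj_on f X"
    using f unfolding isometry_between_def bij_betw_def by auto
  show ?thesis
    using assms(3,4) inj by unfold_locales (auto simp: Y e triangle inj_on_eq_iff)
qed

lemma delta_closed_image: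
  assumes M: "Metric_space X d" and N: "Metric_space Y e"
    and f: "isometry_between X d Y e f" and A: "delta_closed \<delta> X d A"
  shows "delta_closed \<delta> Y e (f ` A)"
proof -
  have AX: "A \<subseteq> X" and "A \<noteq> {}"
    using delta_closed_subset[OF A] delta_closed_nonempty[OF A] by auto
  have Y: "Y = f ` X" and e: "\<And>x y. x \<in> X \<Longrightarrow> y \<in> X \<Longrightarrow> e (f x) (f y) = d x y"
    using f unfolding isometry_between_def bij_betw_def by auto
  have gate: "is_gate e (f ` A) (f b) (f g)" if "b \<in> X" "is_gate d A b g" for b g
  proof (rule is_gateI)
    show "f g \<in> f ` A" using is_gate_mem[OF that(2)] by simp
    fix a assume "a \<in> f ` A"
    then obtain a' where a': "a = f a'" "a' \<in> A" by auto
    then have "a' \<in> X" "g \<in> X" using AX is_gate_mem[OF that(2)] by auto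
    then show "e (f b) a = e (f b) (f g) + e (f g) a"
      using is_gate_dist[OF that(2) a'(2)] a'(1) that(1) by (simp add: e)
  qed
  \<comment> \<open>The criterion \<open>delta_closed_iff\<close> quantifies over arbitrary gates in
    the image, so these have to be pulled back to gates in \<open>A\<close>.\<close>
  have gate': "\<exists>g\<in>X. g' = f g \<and> is_gate d A b g"
    if b: "b \<in> X" and g': "is_gate e (f ` A) (f b) g'" for b g'
  proof -
    obtain g where g: "g' = f g" "g \<in> A" using is_gate_mem[OF g'] by auto
    moreover have "g \<in> X" using g(2) AX by auto
    moreover have "is_gate d A b g"
    proof (rule is_gateI[OF g(2)])
      fix a assume a: "a \<in> A"
      then have "f a \<in> f ` A" "a \<in> X" using AX by auto
      then show "d b a = d b g + d g a"
        using is_gate_dist[OF g', of "f a"] b \<open>g \<in> X\<close> by (simp add: e g(1))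
    qed
    ultimately show ?thesis by auto
  qed
  have "\<exists>g. is_gate e (f ` A) b g" if "b \<in> Y" for b
  proof -
    obtain c where c: "c \<in> X" "b = f c" using \<open>b \<in> Y\<close> Y by auto
    obtain g where "is_gate d A c g" by (rule delta_closed_gate_exists[OF M A c(1)])
    then show ?thesis using gate[OF c(1)] c(2) by auto
  qed
  moreover have "e b b' = e b g + e g g' + e g' b'"
    if b: "b \<in> Y" "b' \<in> Y" and g: "is_gate e (f ` A) b g" "is_gate e (f ` A) b' g'" and gt: "e g g' > \<delta>"
    for b b' g g'
  proof -
    obtain c c' where c: "c \<in> X" "b = f c" "c' \<in> X" "b' = f c'" using b Y by auto
    obtain u where u: "u \<in> X" "g = f u" "is_gate d A c u" using gate' c g(1) by blast
    obtain u' where u': "u' \<in> X" "g' = f u'" "is_gate d A c' u'" using gate' c g(2) by blast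
    show ?thesis
      using delta_closed_dist[OF M A c(1,3) u(3) u'(3)] gt c u u' by (simp add: e)
  qed
  ultimately show ?thesis
    unfolding delta_closed_iff[OF N] using \<open>A \<noteq> {}\<close> AX Y by auto
qed

lemma isometry_between_trans:
  assumes "isometry_between X d Y e f" "isometry_between Y e Z d' h"
  shows "isometry_between X d Z d' (h \<circ> f)"
  using assms bij_betw_trans unfolding isometry_between_def
  by (auto simp: bij_betw_apply)

lemma isometry_between_subset:
  assumes "isometry_between X d Y e f" "A \<subseteq> X"
  shows "isometry_between A d (f ` A) e f"
  using assms unfolding isometry_between_def bij_betw_def
  by (auto intro: inj_on_subset)

lemma isometry_between_inv_into:
  assumes "isometry_between X d Y e f"
  shows "isometry_between Y e X d (inv_into X f)"
proof -
  have f: "bij_betw f X Y" "\<And>x y. x \<in> X \<Longrightarrow> y \<in> X \<Longrightarrow> e (f x) (f y) = d x y"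
    using assms unfolding isometry_between_def by auto
  have "d (inv_into X f x) (inv_into X f y) = e x y" if "x \<in> Y" "y \<in> Y" for x y
    using f(2)[of "inv_into X f x" "inv_into X f y"] that
      bij_betw_inv_into_right[OF f(1)] bij_betw_apply[OF bij_betw_inv_into[OF f(1)]] by simp
  then show ?thesis using bij_betw_inv_into[OF f(1)] unfolding isometry_between_def by simp
qed

text \<open>Allows carriers of any type in the embedding property, which is stated for carriers in
  \<^typ>\<open>nat\<close>.\<close>

lemma H_delta_embeds:
  fixes F :: "'b set"
  assumes H: "is_H_delta \<delta> H d"
    and F: "finite F" "F \<noteq> {}" "hyperbolic \<delta> F e" "rational_distances F e"
  obtains A f where "delta_closed \<delta> H d A" "isometry_between F e A d f"
proof -
  obtain u :: "'b \<Rightarrow> nat" where u: "inj_on u F"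
    using finite_imp_inj_to_nat_seg[OF F(1)] by blast
  define v where "v = inv_into F u"
  have vu: "v (u x) = x" if "x \<in> F" for x using u that by (simp add: v_def)
  \<comment> \<open>Pulling \<open>e\<close> back along \<open>v\<close> on all of
    \<open>nat\<close> keeps it nonnegative and symmetric off the carrier too.\<close>
  define e' where "e' = (\<lambda>i j. e (v i) (v j))"
  have MF: "Metric_space F e" using F(3) unfolding hyperbolic_def by blast
  have iso: "isometry_between F e (u ` F) e' u"
    using u vu unfolding isometry_between_def e'_def bij_betw_def by auto
  have "Metric_space (u ` F) e'"
    using Metric_space.nonneg[OF MF] Metric_space.commute[OF MF]
    by (intro isometry_between_metric_space[OF MF iso]) (auto simp: e'_def)
  then have "hyperbolic \<delta> (u ` F) e'"
    using F(3) unfolding hyperbolic_def by (auto simp: e'_def vu)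
  moreover have "rational_distances (u ` F) e'"
    using F(4) unfolding rational_distances_def by (auto simp: e'_def vu)
  moreover have "finite (u ` F)" "u ` F \<noteq> {}" using F(1,2) by auto
  moreover have "\<forall>(F :: nat set) e. finite F \<and> F \<noteq> {} \<and> hyperbolic \<delta> F e \<and> rational_distances F e \<longrightarrow>
      (\<exists>A f. delta_closed \<delta> H d A \<and> isometry_between F e A d f)"
    using H unfolding is_H_delta_def by (elim conjE)
  ultimately obtain A f where "delta_closed \<delta> H d A" "isometry_between (u ` F) e' A d f"
    by metis
  then show thesis using that isometry_between_trans[OF iso] by blast
qed

section \<open>Realising finite extensions over a closed set\<close>

text \<open>Universality gives some closed copy of \<open>F\<close> in \<open>H\<close>. The copy of
  \<open>D\<close> inside it is closed in \<open>H\<close> by transitivity, so homogeneity moves it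
  back onto \<open>C\<close>, carrying the copy of \<open>F\<close> along.\<close>

lemma H_delta_extension:
  fixes F :: "'b set"
  assumes H: "is_H_delta \<delta> H d" and C: "finite C" "delta_closed \<delta> H d C"
    and F: "finite F" "hyperbolic \<delta> F e" "rational_distances F e"
    and D: "delta_closed \<delta> F e D" and \<iota>: "isometry_between C d D e \<iota>"
  obtains A \<phi> where "delta_closed \<delta> H d A" "isometry_between F e A d \<phi>"
    "\<And>c. c \<in> C \<Longrightarrow> \<phi> (\<iota> c) = c"
proof -
  have MH: "Metric_space H d" and MF: "Metric_space F e"
    using H F unfolding is_H_delta_def hyperbolic_def by blast+
  have DF: "D \<subseteq> F" using D by (rule delta_closed_subset)
  have "F \<noteq> {}" using DF delta_closed_nonempty[OF D] by auto
  obtain A f where A: "delta_closed \<delta> H d A" and f: "isometry_between F e A d f"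
    by (rule H_delta_embeds[OF H F(1) \<open>F \<noteq> {}\<close> F(2,3)])
  have AH: "A \<subseteq> H" using A by (rule delta_closed_subset)
  have MA: "Metric_space A d" using MH AH by (rule Metric_space.subspace)
  have fD: "delta_closed \<delta> H d (f ` D)"
    by (rule delta_closed_trans[OF MH A delta_closed_image[OF MF MA f D]])
  have iso: "isometry_between C d (f ` D) d (f \<circ> \<iota>)"
    by (rule isometry_between_trans[OF \<iota> isometry_between_subset[OF f DF]])
  have "finite (f ` D)" using F(1) DF finite_subset by auto
  moreover have "\<forall>A B f. finite A \<and> finite B \<and> delta_closed \<delta> H d A \<and> delta_closed \<delta> H d B \<and>
      isometry_between A d B d f \<longrightarrow>
      (\<exists>h. isometry_between H d H d h \<and> (\<forall>x\<in>A. h x = f x))"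
    using H unfolding is_H_delta_def by (elim conjE)
  ultimately obtain h where h: "isometry_between H d H d h"
    "\<forall>x\<in>f ` D. h x = inv_into C (f \<circ> \<iota>) x"
    using C fD isometry_between_inv_into[OF iso] by metis
  show thesis
  proof
    show "delta_closed \<delta> H d (h ` A)" by (rule delta_closed_image[OF MH MH h(1) A])
    show "isometry_between F e (h ` A) d (h \<circ> f)"
      by (rule isometry_between_trans[OF f isometry_between_subset[OF h(1) AH]])
    show "(h \<circ> f) (\<iota> c) = c" if "c \<in> C" for c
    proof -
      have bij: "bij_betw (f \<circ> \<iota>) C (f ` D)" using iso unfolding isometry_between_def by simp
      have "h ((f \<circ> \<iota>) c) = inv_into C (f \<circ> \<iota>) ((f \<circ> \<iota>) c)"
        by (intro bspec[OF h(2)] bij_betw_apply[OF bij that])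
      then show ?thesis using bij_betw_inv_into_left[OF bij that] by simp
    qed
  qed
qed

section \<open>Hanging a point on an edge\<close>

text \<open>The option type supplies a fresh point: \<open>None\<close> is the free end of an edge
  of length \<open>N\<close> glued at \<open>x\<close>.\<close>

fun hang :: "('a \<Rightarrow> 'a \<Rightarrow> real) \<Rightarrow> 'a \<Rightarrow> real \<Rightarrow> 'a option \<Rightarrow> 'a option \<Rightarrow> real" where
  "hang d x N (Some a) (Some b) = d a b"
| "hang d x N None (Some b) = N + d x b"
| "hang d x N (Some a) None = N + d x a"
| "hang d x N None None = 0"

lemma hyperbolic_hang:
  fixes C :: "'a set"
  assumes "0 \<le> \<delta>" "hyperbolic \<delta> C d" "x \<in> C" "0 < N"
  shows "hyperbolic \<delta> (insert None (Some ` C)) (hang d x N)"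
proof -
  interpret Metric_space C d using assms(2) unfolding hyperbolic_def by blast
  define \<pi> where "\<pi> = case_option x id"
  define w :: "'a option \<Rightarrow> real" where "w = case_option N (\<lambda>_. 0)"
  let ?F = "insert None (Some ` C)" and ?D = "hang d x N"
  \<comment> \<open>Here \<pi> projects to \<open>C\<close> and \<open>w\<close> is the distance to
    the projection; only the pair of two \<open>None\<close>s escapes the uniform formula.\<close>
  have hang_eq: "?D u v = (if u = None \<and> v = None then 0 else d (\<pi> u) (\<pi> v) + w u + w v)" for u v
    by (cases u; cases v) (auto simp: \<pi>_def w_def commute)
  have \<pi>: "\<pi> u \<in> C" if "u \<in> ?F" for u using that assms(3) by (auto simp: \<pi>_def)
  have \<pi>_None: "\<pi> None = x" and w_None: "w None = N" and w_Some: "u \<noteq> None \<Longrightarrow> w u = 0" for u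
    by (auto simp: \<pi>_def w_def)
  have xx: "d x x = 0" using assms(3) by simp
  have tri: "d p r \<le> d x p + d x r" if "p \<in> C" "r \<in> C" for p r
    using triangle[OF that(1) assms(3) that(2)] commute[of p x] by simp
  have "Metric_space ?F ?D"
  proof
    show "0 \<le> ?D a b" for a b
      using assms(4) by (cases a; cases b) auto
    show "?D a b = ?D b a" for a b
      by (cases a; cases b) (auto simp: commute)
    show "?D a b = 0 \<longleftrightarrow> a = b" if "a \<in> ?F" "b \<in> ?F" for a b
    proof -
      have "N + d x c \<noteq> 0" for c using assms(4) nonneg[of x c] by linarith
      then show ?thesis using that by auto
    qed
    show "?D a c \<le> ?D a b + ?D b c" if "a \<in> ?F" "b \<in> ?F" "c \<in> ?F" for a b c
      using triangle[OF \<pi>[OF that(1)] \<pi>[OF that(2)] \<pi>[OF that(3)]]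
        tri[OF \<pi>[OF that(1)] \<pi>[OF that(3)]] assms(4) xx nonneg[of x]
        commute[of "\<pi> a" x] commute[of "\<pi> b" x]
      by (cases "a = None"; cases "b = None"; cases "c = None")
        (simp_all add: hang_eq \<pi>_None w_None w_Some)
  qed
  moreover have "?D a f + ?D b c \<le> max (?D a b + ?D c f) (?D a c + ?D b f) + 2 * \<delta>"
    if "a \<in> ?F" "b \<in> ?F" "c \<in> ?F" "f \<in> ?F" for a b c f
  proof -
    note \<pi>s = \<pi>[OF that(1)] \<pi>[OF that(2)] \<pi>[OF that(3)] \<pi>[OF that(4)]
    have "d (\<pi> a) (\<pi> f) + d (\<pi> b) (\<pi> c) \<le>
        max (d (\<pi> a) (\<pi> b) + d (\<pi> c) (\<pi> f)) (d (\<pi> a) (\<pi> c) + d (\<pi> b) (\<pi> f)) + 2 * \<delta>"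
      using assms(2) \<pi>s unfolding hyperbolic_def by blast
    \<comment> \<open>Each of the three sums uses all four points once, so the weights
      \<open>w\<close> cancel when \<open>None\<close> occurs at most once. With repetitions, either
      the left side equals a sum on the right or \<open>tri\<close> bounds it.\<close>
    then show ?thesis
      using tri[OF \<pi>s(1) \<pi>s(4)] tri[OF \<pi>s(2) \<pi>s(3)] assms(1,4) xx
        commute[of "\<pi> a" x] commute[of "\<pi> b" x] commute[of "\<pi> c" x] commute[of "\<pi> f" x]
      unfolding max_def
      by (cases "a = None"; cases "b = None"; cases "c = None"; cases "f = None")
        (auto simp: hang_eq \<pi>_None w_None w_Some split: if_splits)
  qed
  ultimately show ?thesis unfolding hyperbolic_def by blast
qed

text \<open>The only outside point is \<open>None\<close>, with gate \<open>Some x\<close>. The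
  distance condition thus compares its gate with itself, at distance 0, which is not above
  \<delta>.\<close>

lemma delta_closed_hang:
  assumes "0 \<le> \<delta>" "hyperbolic \<delta> C d" "x \<in> C" "0 < N"
  shows "delta_closed \<delta> (insert None (Some ` C)) (hang d x N) (Some ` C)"
proof -
  interpret Metric_space C d using assms(2) unfolding hyperbolic_def by blast
  have "is_gate (hang d x N) (Some ` C) None (Some x)"
    using assms(3) by (intro is_gateI) auto
  then have "gated (insert None (Some ` C)) (hang d x N) (Some ` C)"
    unfolding gated_def by auto
  moreover have "gate (hang d x N) (Some ` C) None \<in> Some ` C"
    using is_gate_gate[OF _ calculation, of None] hyperbolic_hang[OF assms]
    by (auto simp: hyperbolic_def dest: is_gate_mem)
  ultimately show ?thesis
    using assms(1,3) unfolding delta_closed_def by auto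
qed

text \<open>The extension lemma realises the hung space with \<open>C\<close> fixed pointwise, so
  its image is \<open>C\<close> with the single point \<open>q\<close> = \<open>\<phi> None\<close>
  added. Rational \<open>N\<close> keeps the distances rational, as universality demands.\<close>

lemma H_delta_hang:
  assumes "0 \<le> \<delta>" and H: "is_H_delta \<delta> H d"
    and C: "finite C" "delta_closed \<delta> H d C" "x \<in> C" and N: "0 < N" "N \<in> \<rat>"
  obtains q where "delta_closed \<delta> H d (insert q C)" "\<And>c. c \<in> C \<Longrightarrow> d q c = N + d x c"
proof -
  let ?F = "insert None (Some ` C)"
  have MH: "Metric_space H d" and hypH: "hyperbolic \<delta> H d" and rat: "rational_distances H d"
    using H unfolding is_H_delta_def hyperbolic_def by (elim conjE; simp)+
  have CH: "C \<subseteq> H" using C(2) by (rule delta_closed_subset)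
  have hypC: "hyperbolic \<delta> C d"
    using hypH CH Metric_space.subspace[OF MH CH] unfolding hyperbolic_def by (simp add: subset_iff)
  have "rational_distances ?F (hang d x N)"
    using rat CH N(2) C(3) unfolding rational_distances_def by (auto simp: subset_iff)
  moreover have "isometry_between C d (Some ` C) (hang d x N) Some"
    unfolding isometry_between_def bij_betw_def by auto
  ultimately obtain A \<phi> where A: "delta_closed \<delta> H d A"
    and \<phi>: "isometry_between ?F (hang d x N) A d \<phi>" "\<And>c. c \<in> C \<Longrightarrow> \<phi> (Some c) = c"
    using H_delta_extension[OF H C(1,2) _ hyperbolic_hang[OF assms(1) hypC C(3) N(1)] _
        delta_closed_hang[OF assms(1) hypC C(3) N(1)]] C(1)
    by (metis finite.insertI finite_imageI)
  have "A = \<phi> ` ?F" using \<phi>(1) unfolding isometry_between_def bij_betw_def by simp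
  also have "\<dots> = insert (\<phi> None) C" using \<phi>(2) by force
  finally have "delta_closed \<delta> H d (insert (\<phi> None) C)" using A by simp
  moreover have "d (\<phi> None) c = N + d x c" if "c \<in> C" for c
  proof -
    have "d (\<phi> None) (\<phi> (Some c)) = hang d x N None (Some c)"
      using \<phi>(1) that unfolding isometry_between_def by blast
    then show ?thesis using \<phi>(2) that by simp
  qed
  ultimately show thesis using that by blast
qed

section \<open>The displacement argument\<close>

theorem corollary6p5:
  fixes \<delta> :: real and H :: "'a set" and d :: "'a \<Rightarrow> 'a \<Rightarrow> real" and g :: "'a \<Rightarrow> 'a"
  assumes "\<delta> \<ge> 0"
    and "is_H_delta \<delta> H d"
    and "isometry_between H d H d g"
    and "bounded_displacement H d g"
  shows "\<forall>x\<in>H. g x = x"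
proof (intro ballI, rule ccontr)
  fix x assume x: "x \<in> H" and neq: "g x \<noteq> x"
  interpret Metric_space H d using assms(2) unfolding is_H_delta_def hyperbolic_def by blast
  have gH: "g y \<in> H" if "y \<in> H" for y
    using assms(3) that unfolding isometry_between_def bij_betw_def by auto
  have gd: "d (g y) (g z) = d y z" if "y \<in> H" "z \<in> H" for y z
    using assms(3) that unfolding isometry_between_def by blast
  obtain K where K: "\<And>y. y \<in> H \<Longrightarrow> d y (g y) \<le> K"
    using assms(4) unfolding bounded_displacement_def bdd_above_def by auto
  obtain S :: "nat \<Rightarrow> 'a set" where S: "incseq S" "(\<Union>n. S n) = H"
    "\<And>n. finite (S n)" "\<And>n. delta_closed \<delta> H d (S n)"
    using assms(2) unfolding is_H_delta_def by (elim conjE exE) simp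
  obtain m n where "x \<in> S m" "g x \<in> S n" using x gH[OF x] S(2) by blast
  then have Smn: "x \<in> S (max m n)" "g x \<in> S (max m n)"
    using monoD[OF S(1), of m "max m n"] monoD[OF S(1), of n "max m n"] by auto
  obtain C where C: "finite C" "delta_closed \<delta> H d C" "x \<in> C" "g x \<in> C"
    by (rule that[OF S(3,4) Smn])
  \<comment> \<open>A natural number serves as edge length: it is rational, positive and above the
    displacement bound \<open>K\<close>.\<close>
  obtain r :: nat where r: "max K 0 < real r" using reals_Archimedean2 by blast
  obtain q where q: "delta_closed \<delta> H d (insert q C)"
    and dq: "\<And>c. c \<in> C \<Longrightarrow> d q c = real r + d x c"
    using H_delta_hang[OF assms(1,2) C(1-3), of "real r"] r by auto
  have qH: "q \<in> H" using delta_closed_subset[OF q] by simp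
  \<comment> \<open>Points of the closed set count as their own gates, so the position of
    \<open>g q\<close> is irrelevant here.\<close>
  obtain z where z: "is_gate d (insert q C) (g q) z"
    by (rule delta_closed_gate_exists[OF Metric_space_axioms q gH[OF qH]])
  then consider "z = q" | "z \<in> C" using is_gate_mem by fast
  then show False
  proof cases
    case 1
    then have "d (g q) (g x) = d (g q) q + d q (g x)"
      using is_gate_dist[OF z, of "g x"] C(4) by simp
    moreover have "d (g q) (g x) = real r" using gd[OF qH x] dq[OF C(3)] x by simp
    moreover have "0 < d x (g x)" using neq x gH[OF x] by (metis mdist_pos_eq)
    ultimately show False using dq[OF C(4)] nonneg[of "g q" q] by linarith
  next
    case 2
    \<comment> \<open>The second summand is \<open>d z q\<close> = \<open>r + d x z\<close>, which
      already exceeds \<open>K\<close>.\<close>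
    have "d (g q) q = d (g q) z + d z q" using is_gate_dist[OF z, of q] by simp
    then show False
      using dq[OF 2] K[OF qH] r nonneg[of "g q" z] nonneg[of x z] commute[of z q]
        commute[of q "g q"] by linarith
  qed
qed

end
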